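(* Let $(\psi_n)_{n\ge1}$ be a sequence of real-valued convex functions on $\mathbb{R}^d$. For $x\in\mathbb{R}^d$ let $$I^{\mathrm{b}}(x):=\Big\{y\in\mathbb{R}^d:\ \lim_{\varepsilon\downarrow0}\ \sup_{n\ge1}\ \sup_{\psi_n^{x,\varepsilon}\in[\psi_n]^{x,\varepsilon}}\psi_n^{x,\varepsilon}(y)<+\infty\Big\},\qquad I^{\mathrm{B}}(x):=\operatorname{ri}I^{\mathrm{b}}(x).$$ Then the collection $\{I^{\mathrm{B}}(x)\}_{x\in\mathbb{R}^d}$ has the following properties for all $x,x_1\in\mathbb{R}^d$: (i) $x\in I^{\mathrm{B}}(x)$; (ii) if $x_1\in I^{\mathrm{B}}(x)$, then $I^{\mathrm{B}}(x)=I^{\mathrm{B}}(x_1)$; (iii) if $x_1\notin I^{\mathrm{B}}(x)$, then $I^{\mathrm{B}}(x)\cap I^{\mathrm{B}}(x_1)=\varnothing$.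
   Context: For a convex function $\psi\colon\mathbb{R}^d\to\mathbb{R}$, a point $x\in\mathbb{R}^d$ and $\varepsilon>0$, $[\psi]^{x,\varepsilon}$ denotes the set of all convex functions $\psi^{x,\varepsilon}=\psi+\mathrm{aff}$, where $\mathrm{aff}\colon\mathbb{R}^d\to\mathbb{R}$ runs through all affine functions such that $\psi^{x,\varepsilon}\ge0$ on $\mathbb{R}^d$ and $\psi^{x,\varepsilon}(x)<\varepsilon$. The operator $\operatorname{ri}$ denotes the relative interior of a set. *)

theory Defs
  imports "HOL-Analysis.Analysis"
begin

text \<open>
  The set \<open>[\<psi>]\<^sup>x\<^sup>,\<^sup>\<epsilon>\<close>.  The affine functions are the maps \<open>\<lambda>y. f y + c\<close> with \<open>f\<close> linear; the
  members are convex whenever \<open>\<psi>\<close> is.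
\<close>

definition affine_shifts :: "('a::euclidean_space \<Rightarrow> real) \<Rightarrow> 'a \<Rightarrow> real \<Rightarrow> ('a \<Rightarrow> real) set" where
  "affine_shifts \<psi> x \<epsilon> =
     {\<phi>. (\<exists>f c. linear f \<and> \<phi> = (\<lambda>y. \<psi> y + (f y + c))) \<and> (\<forall>y. 0 \<le> \<phi> y) \<and> \<phi> x < \<epsilon>}"

text \<open>
  The suprema are taken in the extended reals, as they may be infinite.
\<close>

definition sup_shifts :: "(nat \<Rightarrow> 'a::euclidean_space \<Rightarrow> real) \<Rightarrow> 'a \<Rightarrow> real \<Rightarrow> 'a \<Rightarrow> ereal" where
  "sup_shifts \<psi> x \<epsilon> y = (SUP n\<in>{1..}. SUP \<phi>\<in>affine_shifts (\<psi> n) x \<epsilon>. ereal (\<phi> y))"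

definition I_b :: "(nat \<Rightarrow> 'a::euclidean_space \<Rightarrow> real) \<Rightarrow> 'a \<Rightarrow> 'a set" where
  "I_b \<psi> x = {y. Lim (at_right 0) (\<lambda>\<epsilon>. sup_shifts \<psi> x \<epsilon> y) < \<infinity>}"

definition I_B :: "(nat \<Rightarrow> 'a::euclidean_space \<Rightarrow> real) \<Rightarrow> 'a \<Rightarrow> 'a set" where
  "I_B \<psi> x = rel_interior (I_b \<psi> x)"

text \<open>
  The limit in \<^const>\<open>I_b\<close> always exists, since the supremum is monotone in \<open>\<epsilon>\<close>; so \<^const>\<open>Lim\<close>,
  which is unspecified for divergent functions, denotes a genuine limit there.
\<close>

lemma sup_shifts_mono:
  assumes "\<epsilon> \<le> \<epsilon>'"
  shows "sup_shifts \<psi> x \<epsilon> y \<le> sup_shifts \<psi> x \<epsilon>' y"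
proof -
  have "affine_shifts (\<psi> n) x \<epsilon> \<subseteq> affine_shifts (\<psi> n) x \<epsilon>'" for n
    using assms by (auto simp: affine_shifts_def)
  then show ?thesis
    unfolding sup_shifts_def by (intro SUP_mono' SUP_subset_mono) auto
qed

lemma sup_shifts_tendsto:
  "((\<lambda>\<epsilon>. sup_shifts \<psi> x \<epsilon> y) \<longlongrightarrow> Lim (at_right 0) (\<lambda>\<epsilon>. sup_shifts \<psi> x \<epsilon> y)) (at_right 0)"
proof -
  let ?F = "\<lambda>\<epsilon>. sup_shifts \<psi> x \<epsilon> y"
  have "(?F \<longlongrightarrow> (INF \<epsilon>\<in>{0<..}. ?F \<epsilon>)) (at_right 0)"
  proof (rule decreasing_tendsto)
    show "\<forall>\<^sub>F \<epsilon> in at_right 0. (INF \<epsilon>\<in>{0<..}. ?F \<epsilon>) \<le> ?F \<epsilon>"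
      using eventually_at_right_less[of "0::real"]
      by eventually_elim (auto intro: INF_lower)
  next
    fix b assume "(INF \<epsilon>\<in>{0<..}. ?F \<epsilon>) < b"
    then obtain e where e: "0 < e" "?F e < b"
      by (auto simp: INF_less_iff)
    show "\<forall>\<^sub>F \<epsilon> in at_right 0. ?F \<epsilon> < b"
      unfolding eventually_at_right_field
    proof (intro exI conjI allI impI)
      show "0 < e" by fact
      show "?F \<epsilon> < b" if "0 < \<epsilon>" "\<epsilon> < e" for \<epsilon>
        using sup_shifts_mono[of \<epsilon> e \<psi> x y] that e by (meson less_imp_le le_less_trans)
    qed
  qed
  then show ?thesis
    by (simp add: tendsto_Lim)
qed

end

(*
  Two ingredients.  First, x lies in the relative interior of the convex set I_b(x): if a nonnegative
  shift with small value at x were large at a point slightly behind x, as seen from y in I_b(x),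
  then Hahn-Banach would give an affine minorant of steep slope, and subtracting it a shift that is
  still small at x but too large at y.  Second, if z lies in the relative interior of I_b(a) and in
  I_b(b), then I_b(a) is contained in I_b(b): subtract from a shift at b its tangent at a; the
  difference is bounded on I_b(a), and the tangent, bounded below on I_b(a) and above at the
  relatively interior point z, is bounded above on I_b(a) too.  Hence two of the sets I_b(x) whose
  relative interiors meet coincide.
*)
theory Submission
  imports Defs
begin

section \<open>Hahn-Banach extension of affine minorants\<close>

text \<open>Separate the strict epigraph of \<open>\<phi>\<close> from the graph \<open>L\<close> of
  the given function on the line. The degenerate case \<open>v = 0\<close>,
  \<open>\<beta> = 0\<close> yields a supporting affine function at \<open>x\<close>.\<close>

lemma convex_affine_minorant_extends:
  fixes \<phi> :: "'a::euclidean_space \<Rightarrow> real"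
  assumes conv: "convex_on UNIV \<phi>" and le: "\<And>t. \<alpha> + \<beta> * t \<le> \<phi> (x + t *\<^sub>R v)"
  obtains f where "linear f" "f v = \<beta>" "\<And>u. \<alpha> + f (u - x) \<le> \<phi> u"
proof -
  define E where "E = {p. \<phi> (fst p) < snd p}"
  define L where "L = range (\<lambda>t. (x + t *\<^sub>R v, \<alpha> + \<beta> * t))"
  have "convex E"
  proof (rule convexI)
    fix p q and s t :: real
    assume pq: "p \<in> E" "q \<in> E" and st: "0 \<le> s" "0 \<le> t" "s + t = 1"
    have "\<phi> (s *\<^sub>R fst p + t *\<^sub>R fst q) \<le> s * \<phi> (fst p) + t * \<phi> (fst q)"
      using conv st by (auto simp: convex_on_def)
    also have "\<dots> < s * snd p + t * snd q"
    proof (cases "s = 0")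
      case False
      then show ?thesis
        using pq st by (intro add_less_le_mono mult_strict_left_mono mult_left_mono)
          (auto simp: E_def)
    qed (use pq st in \<open>auto simp: E_def\<close>)
    finally show "s *\<^sub>R p + t *\<^sub>R q \<in> E" by (simp add: E_def)
  qed
  moreover have "convex L"
  proof (rule convexI)
    fix p q and s t :: real
    assume "p \<in> L" "q \<in> L" and st: "0 \<le> s" "0 \<le> t" "s + t = 1"
    then obtain k l where kl: "p = (x + k *\<^sub>R v, \<alpha> + \<beta> * k)" "q = (x + l *\<^sub>R v, \<alpha> + \<beta> * l)"
      by (auto simp: L_def)
    have "s = 1 - t" using st by simp
    then have "s *\<^sub>R p + t *\<^sub>R q
        = (x + (s * k + t * l) *\<^sub>R v, \<alpha> + \<beta> * (s * k + t * l))"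
      unfolding kl \<open>s = 1 - t\<close> by (simp add: algebra_simps)
    then show "s *\<^sub>R p + t *\<^sub>R q \<in> L" unfolding L_def by blast
  qed
  moreover have "(x, \<phi> x + 1) \<in> E" by (simp add: E_def)
  moreover have "(x, \<alpha>) \<in> L" unfolding L_def by (auto intro!: image_eqI[of _ _ 0])
  moreover have "E \<inter> L = {}" using le by (auto simp: E_def L_def simp flip: not_le)
  ultimately obtain a :: "'a \<times> real" and b where ab: "a \<noteq> 0"
      "\<And>p. p \<in> E \<Longrightarrow> a \<bullet> p \<le> b" "\<And>p. p \<in> L \<Longrightarrow> b \<le> a \<bullet> p"
    using separating_hyperplane_sets[of E L] by blast
  obtain h c where hc: "a = (h, c)" by fastforce
  have E: "h \<bullet> u + c * r \<le> b" if "\<phi> u < r" for u r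
    using ab(2)[of "(u, r)"] that by (simp add: E_def hc)
  have L: "b \<le> h \<bullet> x + t * (h \<bullet> v) + c * (\<alpha> + \<beta> * t)" for t
    using ab(3)[of "(x + t *\<^sub>R v, \<alpha> + \<beta> * t)"] by (auto simp: L_def hc inner_add_right)
  \<comment> \<open>A vertical hyperplane is impossible: \<open>E\<close> projects onto the whole
    space, so \<open>h\<close> would be bounded above and hence zero.\<close>
  have "c \<noteq> 0"
  proof
    assume "c = 0"
    then have "h \<bullet> (x + h) \<le> h \<bullet> x"
      using E[of "x + h" "\<phi> (x + h) + 1"] L[of 0] by simp
    then have "h \<bullet> h \<le> 0" by (simp add: inner_add_right)
    then have "h = 0" by (metis inner_ge_zero inner_eq_zero_iff order_antisym)
    with \<open>c = 0\<close> hc ab(1) show False by (simp add: zero_prod_def)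
  qed
  moreover have "c \<le> 0"
  proof (rule ccontr)
    assume "\<not> c \<le> 0"
    define r where "r = \<bar>\<phi> x\<bar> + \<bar>\<alpha>\<bar> + 1"
    have r: "\<phi> x < r" "\<alpha> < r" unfolding r_def by linarith+
    then have "c * r \<le> c * \<alpha>" using E[of x r] L[of 0] by simp
    with r(2) \<open>\<not> c \<le> 0\<close> show False by simp
  qed
  ultimately have c: "c < 0" by simp
  \<comment> \<open>On \<open>L\<close> the functional is affine in \<open>t\<close> and bounded
    below by \<open>b\<close>, hence constant; the \<open>t\<close> chosen below would give it the
    value \<open>b - 1\<close>.\<close>
  have slope: "h \<bullet> v + c * \<beta> = 0"
  proof (rule ccontr)
    assume ne: "h \<bullet> v + c * \<beta> \<noteq> 0"
    define t where "t = (b - h \<bullet> x - c * \<alpha> - 1) / (h \<bullet> v + c * \<beta>)"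
    have "t * (h \<bullet> v + c * \<beta>) = b - h \<bullet> x - c * \<alpha> - 1" using ne by (simp add: t_def)
    with L[of t] show False by (simp add: algebra_simps)
  qed
  show ?thesis
  proof
    let ?f = "\<lambda>u. (h \<bullet> u) / (- c)"
    show "linear ?f" by (rule linearI) (auto simp: inner_add_right add_divide_distrib)
    show "?f v = \<beta>" using slope c by (simp add: field_simps)
    show "\<alpha> + ?f (u - x) \<le> \<phi> u" for u
    \<comment> \<open>\<open>E\<close> holds only points strictly above the graph, so
      \<open>\<phi> u\<close> is approached from above.\<close>
    proof (rule field_le_epsilon)
      fix e :: real assume "0 < e"
      then have "h \<bullet> u + c * (\<phi> u + e) \<le> h \<bullet> x + c * \<alpha>"
        using E[of u "\<phi> u + e"] L[of 0] by simp
      with c show "\<alpha> + ?f (u - x) \<le> \<phi> u + e"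
        by (simp add: inner_diff_right field_simps)
    qed
  qed
qed

section \<open>Affine shifts of a convex function\<close>

lemma affine_shifts_convex:
  assumes "convex_on UNIV \<psi>" "\<phi> \<in> affine_shifts \<psi> x \<epsilon>"
  shows "convex_on UNIV \<phi>"
proof -
  obtain f c where f: "linear f" "\<phi> = (\<lambda>y. \<psi> y + (f y + c))"
    using assms(2) by (auto simp: affine_shifts_def)
  have "convex_on UNIV (\<lambda>y. f y + c)"
  proof (intro convex_onI)
    fix t u w assume "0 < (t::real)" "t < 1"
    then show "f ((1 - t) *\<^sub>R u + t *\<^sub>R w) + c \<le> (1 - t) * (f u + c) + t * (f w + c)"
      by (simp add: linear_add[OF f(1)] linear_diff[OF f(1)] linear_scale[OF f(1)] algebra_simps)
  qed simp
  then show ?thesis unfolding f(2) by (rule convex_on_add[OF assms(1)])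
qed

text \<open>The source of all new shifts. The minorant equals \<open>\<alpha>\<close> at
  \<open>z\<close>, so the difference is \<open>\<phi> z - \<alpha>\<close> there; the base point
  may thus move from \<open>x\<close> to \<open>z\<close>.\<close>

lemma affine_shifts_subtract_minorant:
  assumes "\<phi> \<in> affine_shifts \<psi> x \<epsilon>" "linear f" "\<And>u. \<alpha> + f (u - z) \<le> \<phi> u"
    and "\<phi> z - \<alpha> < \<delta>"
  shows "(\<lambda>u. \<phi> u - (\<alpha> + f (u - z))) \<in> affine_shifts \<psi> z \<delta>"
proof -
  obtain g c where g: "linear g" "\<phi> = (\<lambda>y. \<psi> y + (g y + c))"
    using assms(1) by (auto simp: affine_shifts_def)
  have "linear (\<lambda>u. g u - f u)" by (rule linear_compose_sub[OF g(1) assms(2)])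
  moreover have "(\<lambda>u. \<phi> u - (\<alpha> + f (u - z)))
      = (\<lambda>u. \<psi> u + ((g u - f u) + (c - \<alpha> + f z)))"
    unfolding g(2) by (auto simp: linear_diff[OF assms(2)])
  ultimately have "\<exists>g c. linear g \<and> (\<lambda>u. \<phi> u - (\<alpha> + f (u - z))) = (\<lambda>u. \<psi> u + (g u + c))"
    by (intro exI[of _ "\<lambda>u. g u - f u"] exI[of _ "c - \<alpha> + f z"] conjI)
  then show ?thesis
    using assms(3,4) by (simp add: affine_shifts_def linear_0[OF assms(2)])
qed

section \<open>The sets \<open>I_b\<close> as sets of uniform boundedness\<close>

text \<open>By monotonicity in \<epsilon>, a limit below infinity amounts to a bound, uniform in
  \<open>n\<close> and \<open>\<phi>\<close>, for a single \<epsilon>.\<close>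

lemma mem_I_b_iff:
  "y \<in> I_b \<psi> x \<longleftrightarrow>
    (\<exists>\<epsilon>>0. \<exists>C. \<forall>n\<ge>1. \<forall>\<phi>\<in>affine_shifts (\<psi> n) x \<epsilon>. \<phi> y \<le> C)"
proof
  assume "y \<in> I_b \<psi> x"
  then have "\<forall>\<^sub>F \<epsilon> in at_right 0. sup_shifts \<psi> x \<epsilon> y < \<infinity>"
    unfolding I_b_def using order_tendstoD(2)[OF sup_shifts_tendsto] by blast
  then obtain e where e: "e > 0" "\<And>\<epsilon>. 0 < \<epsilon> \<Longrightarrow> \<epsilon> < e \<Longrightarrow> sup_shifts \<psi> x \<epsilon> y < \<infinity>"
    unfolding eventually_at_right_field by blast
  then have "sup_shifts \<psi> x (e / 2) y < \<infinity>" by simp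
  \<comment> \<open>If there are no shifts at all, the supremum is minus infinity and any real
    \<open>C\<close> serves.\<close>
  then obtain C where C: "sup_shifts \<psi> x (e / 2) y \<le> ereal C"
    by (cases "sup_shifts \<psi> x (e / 2) y") auto
  then have "\<forall>n\<ge>1. \<forall>\<phi>\<in>affine_shifts (\<psi> n) x (e / 2). \<phi> y \<le> C"
    unfolding sup_shifts_def by (auto simp: SUP_le_iff)
  with e(1) show "\<exists>\<epsilon>>0. \<exists>C. \<forall>n\<ge>1. \<forall>\<phi>\<in>affine_shifts (\<psi> n) x \<epsilon>. \<phi> y \<le> C"
    by (intro exI[of _ "e / 2"]) auto
next
  assume "\<exists>\<epsilon>>0. \<exists>C. \<forall>n\<ge>1. \<forall>\<phi>\<in>affine_shifts (\<psi> n) x \<epsilon>. \<phi> y \<le> C"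
  then obtain \<epsilon> C where e: "\<epsilon> > 0" "\<forall>n\<ge>1. \<forall>\<phi>\<in>affine_shifts (\<psi> n) x \<epsilon>. \<phi> y \<le> C" by blast
  then have C: "sup_shifts \<psi> x \<epsilon> y \<le> ereal C"
    unfolding sup_shifts_def by (auto intro!: SUP_least)
  have "\<forall>\<^sub>F \<delta> in at_right 0. sup_shifts \<psi> x \<delta> y \<le> ereal C"
    unfolding eventually_at_right_field
    using e(1) C sup_shifts_mono[of _ \<epsilon> \<psi> x y] by (meson less_imp_le order_trans)
  then have "Lim (at_right 0) (\<lambda>\<delta>. sup_shifts \<psi> x \<delta> y) \<le> ereal C"
    by (rule tendsto_upperbound[OF sup_shifts_tendsto]) simp
  then show "y \<in> I_b \<psi> x" unfolding I_b_def by auto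
qed

lemma self_mem_I_b: "x \<in> I_b \<psi> x"
  unfolding mem_I_b_iff
  by (intro exI[of _ 1] conjI) (auto simp: affine_shifts_def intro: less_imp_le)

lemma convex_I_b:
  assumes conv: "\<And>n. n \<ge> 1 \<Longrightarrow> convex_on UNIV (\<psi> n)"
  shows "convex (I_b \<psi> x)"
proof (rule convexI)
  fix y z and s t :: real
  assume yz: "y \<in> I_b \<psi> x" "z \<in> I_b \<psi> x" and st: "0 \<le> s" "0 \<le> t" "s + t = 1"
  obtain d C where d: "d > 0" "\<forall>n\<ge>1. \<forall>\<phi>\<in>affine_shifts (\<psi> n) x d. \<phi> y \<le> C"
    using yz(1) unfolding mem_I_b_iff by blast
  obtain e D where e: "e > 0" "\<forall>n\<ge>1. \<forall>\<phi>\<in>affine_shifts (\<psi> n) x e. \<phi> z \<le> D"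
    using yz(2) unfolding mem_I_b_iff by blast
  have "\<phi> (s *\<^sub>R y + t *\<^sub>R z) \<le> s * C + t * D"
    if n: "n \<ge> 1" and \<phi>: "\<phi> \<in> affine_shifts (\<psi> n) x (min d e)" for n \<phi>
  proof -
    have "\<phi> (s *\<^sub>R y + t *\<^sub>R z) \<le> s * \<phi> y + t * \<phi> z"
      using affine_shifts_convex[OF conv[OF n] \<phi>] st by (auto simp: convex_on_def)
    moreover have "\<phi> y \<le> C" "\<phi> z \<le> D"
      using \<phi> n d(2) e(2) by (auto simp: affine_shifts_def)
    ultimately show ?thesis using st by (smt (verit) mult_left_mono)
  qed
  then show "s *\<^sub>R y + t *\<^sub>R z \<in> I_b \<psi> x"
    unfolding mem_I_b_iff using d(1) e(1) by (intro exI[of _ "min d e"]) auto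
qed

text \<open>The prolongation criterion for relative interiors of nonempty convex sets; it reduces
  both main steps to estimates at single points beyond \<open>z\<close>.\<close>

lemma mem_I_B_iff:
  assumes "\<And>n. n \<ge> 1 \<Longrightarrow> convex_on UNIV (\<psi> n)"
  shows "z \<in> I_B \<psi> x \<longleftrightarrow> (\<forall>y\<in>I_b \<psi> x. \<exists>e>1. (1 - e) *\<^sub>R y + e *\<^sub>R z \<in> I_b \<psi> x)"
  unfolding I_B_def
  by (rule convex_rel_interior_iff[OF convex_I_b[OF assms]]) (use self_mem_I_b in auto)

section \<open>The base point is relatively interior\<close>

lemma self_mem_I_B:
  assumes conv: "\<And>n. n \<ge> 1 \<Longrightarrow> convex_on UNIV (\<psi> n)"
  shows "x \<in> I_B \<psi> x"
proof (subst mem_I_B_iff[of \<psi>, OF conv], assumption, rule ballI)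
  fix y assume "y \<in> I_b \<psi> x"
  then obtain \<epsilon> C where \<epsilon>: "\<epsilon> > 0"
      and C: "\<And>n \<phi>. n \<ge> 1 \<Longrightarrow> \<phi> \<in> affine_shifts (\<psi> n) x \<epsilon> \<Longrightarrow> \<phi> y \<le> C"
    unfolding mem_I_b_iff by blast
  \<comment> \<open>\<open>K\<close> is the steepness of the minorant: large enough to violate the
    bound \<open>C\<close> at \<open>y\<close>. The step \<open>\<delta>\<close> makes a rise of
    slope \<open>K\<close> cost only \<open>\<epsilon> / 4\<close>, and it depends on neither
    \<open>n\<close> nor \<open>\<phi>\<close>.\<close>
  define K where "K = max C 0 + 1"
  have K: "K > 0" "K > C" by (auto simp: K_def)
  define v where "v = y - x"
  define \<delta> where "\<delta> = \<epsilon> / (4 * K)"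
  have \<delta>: "\<delta> > 0" "K * \<delta> = \<epsilon> / 4" using \<epsilon> K by (auto simp: \<delta>_def)
  have "\<phi> (x - \<delta> *\<^sub>R v) \<le> \<epsilon> / 2"
    if n: "n \<ge> 1" and \<phi>: "\<phi> \<in> affine_shifts (\<psi> n) x (\<epsilon> / 4)" for n \<phi>
  proof -
    have pos: "\<And>u. 0 \<le> \<phi> u" and small: "\<phi> x < \<epsilon> / 4"
      using \<phi> by (auto simp: affine_shifts_def)
    have conv\<phi>: "convex_on UNIV \<phi>" by (rule affine_shifts_convex[OF conv[OF n] \<phi>])
    \<comment> \<open>Subtracting a minorant with value \<open>\<alpha>\<close> at \<open>x\<close>
      leaves \<open>\<epsilon> / 2\<close> there, still below \<epsilon>. Moreover
      \<open>\<alpha>\<close> is negative, so towards \<open>y\<close> the descending line stays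
      below the nonnegative \<open>\<phi>\<close>.\<close>
    define \<alpha> where "\<alpha> = \<phi> x - \<epsilon> / 2"
    have "\<exists>\<tau>. 0 < \<tau> \<and> \<phi> (x - \<tau> *\<^sub>R v) < \<alpha> + K * \<tau>"
    proof (rule ccontr)
      assume no: "\<nexists>\<tau>. 0 < \<tau> \<and> \<phi> (x - \<tau> *\<^sub>R v) < \<alpha> + K * \<tau>"
      have "\<alpha> + (- K) * t \<le> \<phi> (x + t *\<^sub>R v)" for t
      proof (cases "t < 0")
        case True
        then show ?thesis using no[simplified, rule_format, of "- t"] by simp
      next
        case False
        then have "K * t \<ge> 0" using K by simp
        then show ?thesis using pos[of "x + t *\<^sub>R v"] small \<epsilon> by (simp add: \<alpha>_def)
      qed
      then obtain f where f: "linear f" "f v = - K" "\<And>u. \<alpha> + f (u - x) \<le> \<phi> u"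
        using convex_affine_minorant_extends[OF conv\<phi>] by blast
      have "(\<lambda>u. \<phi> u - (\<alpha> + f (u - x))) \<in> affine_shifts (\<psi> n) x \<epsilon>"
        by (rule affine_shifts_subtract_minorant[OF \<phi> f(1,3)]) (use \<epsilon> in \<open>simp add: \<alpha>_def\<close>)
      from C[OF n this] have "\<phi> y - (\<alpha> - K) \<le> C" using f(2) by (simp add: v_def)
      then show False using pos[of y] small K \<epsilon> by (simp add: \<alpha>_def)
    qed
    then obtain \<tau> where \<tau>: "0 < \<tau>" "\<phi> (x - \<tau> *\<^sub>R v) < \<alpha> + K * \<tau>" by blast
    \<comment> \<open>Nonnegativity of \<open>\<phi>\<close> forces the line of slope
      \<open>K\<close> to be positive at \<open>\<tau>\<close>, which places \<open>\<tau>\<close>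
      beyond \<open>\<delta>\<close>; convexity then interpolates between \<open>x\<close> and the
      point at \<open>\<tau>\<close>.\<close>
    have "K * \<delta> < K * \<tau>" using \<tau> pos[of "x - \<tau> *\<^sub>R v"] small \<delta> by (simp add: \<alpha>_def)
    then have "\<delta> < \<tau>" using K by simp
    define s where "s = \<delta> / \<tau>"
    have s: "0 \<le> s" "s \<le> 1" "s * \<tau> = \<delta>" using \<delta> \<tau> \<open>\<delta> < \<tau>\<close> by (auto simp: s_def)
    have "x - \<delta> *\<^sub>R v = (1 - s) *\<^sub>R x + s *\<^sub>R (x - \<tau> *\<^sub>R v)"
      unfolding s(3)[symmetric] by (simp add: algebra_simps)
    then have "\<phi> (x - \<delta> *\<^sub>R v) \<le> (1 - s) * \<phi> x + s * \<phi> (x - \<tau> *\<^sub>R v)"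
      using convex_onD[OF conv\<phi> s(1,2)] by simp
    also have "\<dots> \<le> (1 - s) * \<phi> x + s * (\<phi> x + K * \<tau>)"
      using \<tau> s \<epsilon> by (intro add_left_mono mult_left_mono) (auto simp: \<alpha>_def)
    also have "\<dots> = \<phi> x + K * \<delta>" unfolding s(3)[symmetric] by (simp add: algebra_simps)
    finally show ?thesis using small \<delta> by simp
  qed
  then have "x - \<delta> *\<^sub>R v \<in> I_b \<psi> x"
    unfolding mem_I_b_iff using \<epsilon> by (intro exI[of _ "\<epsilon> / 4"] conjI exI[of _ "\<epsilon> / 2"]) auto
  moreover have "(1 - (1 + \<delta>)) *\<^sub>R y + (1 + \<delta>) *\<^sub>R x = x - \<delta> *\<^sub>R v"
    by (simp add: v_def algebra_simps)
  ultimately show "\<exists>e>1. (1 - e) *\<^sub>R y + e *\<^sub>R x \<in> I_b \<psi> x"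
    using \<delta> by (intro exI[of _ "1 + \<delta>"]) simp
qed

section \<open>Relative interiors that meet\<close>

lemma I_b_subset:
  assumes conv: "\<And>n. n \<ge> 1 \<Longrightarrow> convex_on UNIV (\<psi> n)"
    and z: "z \<in> I_B \<psi> a" "z \<in> I_b \<psi> b"
  shows "I_b \<psi> a \<subseteq> I_b \<psi> b"
proof
  fix y assume y: "y \<in> I_b \<psi> a"
  then obtain e where e: "e > 1" and y': "(1 - e) *\<^sub>R y + e *\<^sub>R z \<in> I_b \<psi> a"
    using z(1) mem_I_B_iff[of \<psi>, OF conv] by blast
  define y' where "y' = (1 - e) *\<^sub>R y + e *\<^sub>R z"
  obtain d1 C1 where d1: "d1 > 0"
      and C1: "\<And>n \<phi>. n \<ge> 1 \<Longrightarrow> \<phi> \<in> affine_shifts (\<psi> n) a d1 \<Longrightarrow> \<phi> y \<le> C1"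
    using y unfolding mem_I_b_iff by blast
  obtain d2 C2 where d2: "d2 > 0"
      and C2: "\<And>n \<phi>. n \<ge> 1 \<Longrightarrow> \<phi> \<in> affine_shifts (\<psi> n) a d2 \<Longrightarrow> \<phi> y' \<le> C2"
    using y' unfolding mem_I_b_iff y'_def by blast
  obtain d3 C3 where d3: "d3 > 0"
      and C3: "\<And>n \<phi>. n \<ge> 1 \<Longrightarrow> \<phi> \<in> affine_shifts (\<psi> n) b d3 \<Longrightarrow> \<phi> z \<le> C3"
    using z(2) unfolding mem_I_b_iff by blast
  \<comment> \<open>For the tangent \<open>l\<close> at \<open>a\<close>, \<open>l z\<close> is at
    most \<open>C3\<close> and \<open>l y'\<close> at least \<open>- C2\<close>. As \<open>z\<close>
    lies between \<open>y\<close> and \<open>y'\<close>, this bounds \<open>l y\<close> by the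
    quotient, and \<open>C1\<close> bounds \<open>\<phi> y - l y\<close>.\<close>
  have "\<phi> y \<le> C1 + (e * C3 + C2) / (e - 1)"
    if n: "n \<ge> 1" and \<phi>: "\<phi> \<in> affine_shifts (\<psi> n) b d3" for n \<phi>
  proof -
    have pos: "0 \<le> \<phi> y'" using \<phi> by (auto simp: affine_shifts_def)
    have "\<phi> a + 0 * t \<le> \<phi> (a + t *\<^sub>R 0)" for t by simp
    then obtain f where f: "linear f" "\<And>u. \<phi> a + f (u - a) \<le> \<phi> u"
      using convex_affine_minorant_extends[OF affine_shifts_convex[OF conv[OF n] \<phi>]] by blast
    define l where "l u = \<phi> a + f (u - a)" for u
    \<comment> \<open>The difference vanishes at \<open>a\<close>, so it is a shift there for every
      positive tolerance, in particular for both \<open>d1\<close> and \<open>d2\<close>.\<close>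
    have "(\<lambda>u. \<phi> u - (\<phi> a + f (u - a))) \<in> affine_shifts (\<psi> n) a d" if "d > 0" for d
      by (rule affine_shifts_subtract_minorant[OF \<phi> f]) (use that in simp)
    from C1[OF n this[OF d1]] C2[OF n this[OF d2]]
    have *: "\<phi> y - l y \<le> C1" "\<phi> y' - l y' \<le> C2" by (auto simp: l_def)
    have "l z \<le> C3" using f(2)[of z] C3[OF n \<phi>] by (simp add: l_def)
    then have "e * l z \<le> e * C3" using e by simp
    moreover have "l y' = (1 - e) * l y + e * l z"
      unfolding l_def y'_def
      by (simp add: linear_diff[OF f(1)] linear_add[OF f(1)] linear_scale[OF f(1)] algebra_simps)
    ultimately have "(e - 1) * l y \<le> e * C3 + C2"
      using *(2) pos by (simp add: algebra_simps)
    then have "l y \<le> (e * C3 + C2) / (e - 1)" using e by (simp add: field_simps)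
    with *(1) show ?thesis by simp
  qed
  with d3 show "y \<in> I_b \<psi> b" unfolding mem_I_b_iff by blast
qed

text \<open>Gives (ii) with \<open>x\<^sub>1\<close> as the common point, and (iii) by
  contraposition, since \<open>x\<^sub>1\<close> lies in its own set.\<close>

lemma I_B_eq_if_common_point:
  assumes "\<And>n. n \<ge> 1 \<Longrightarrow> convex_on UNIV (\<psi> n)" "z \<in> I_B \<psi> a" "z \<in> I_B \<psi> b"
  shows "I_B \<psi> a = I_B \<psi> b"
proof -
  have "z \<in> I_b \<psi> a" "z \<in> I_b \<psi> b"
    using assms(2,3) rel_interior_subset unfolding I_B_def by blast+
  then have "I_b \<psi> a = I_b \<psi> b"
    using I_b_subset[OF assms(1)] assms(2,3) by (intro equalityI) auto
  then show ?thesis by (simp add: I_B_def)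
qed

theorem proposition2p3:
  fixes \<psi> :: "nat \<Rightarrow> real ^ 'd \<Rightarrow> real"
    and x x\<^sub>1 :: "real ^ 'd"
  assumes "\<And>n. n \<ge> 1 \<Longrightarrow> convex_on UNIV (\<psi> n)"
  shows "x \<in> I_B \<psi> x \<and>
    (x\<^sub>1 \<in> I_B \<psi> x \<longrightarrow> I_B \<psi> x = I_B \<psi> x\<^sub>1) \<and>
    (x\<^sub>1 \<notin> I_B \<psi> x \<longrightarrow> I_B \<psi> x \<inter> I_B \<psi> x\<^sub>1 = {})"
  using self_mem_I_B[of \<psi>, OF assms] I_B_eq_if_common_point[of \<psi>, OF assms] by blast

end
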